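(* Let $m\ge 1$ and $n\ge 0$ be integers. The Doob graph $D(m,n)$ can be obtained from the Hamming graph $H(2m+n,4)$ by Godsil--McKay switching $m$ times; that is, there exist graphs $\Gamma_0=H(2m+n,4),\Gamma_1,\dots,\Gamma_m$ such that for each $k\in[m]$, $\Gamma_k$ is isomorphic to $\mathrm{sw}_{\pi_k}\Gamma_{k-1}$ for some Godsil--McKay partition $\pi_k$ of $\Gamma_{k-1}$, and $\Gamma_m\cong D(m,n)$.
   Context: A partition $\{C_1,\dots,C_t\}$ of a vertex set is equitable if for all $i,j$ any two vertices of $C_i$ have the same number of neighbours in $C_j$. A partition $\pi=\{C_1,\dots,C_t,D\}$ of $V(\Gamma)$ is a Godsil--McKay partition with Godsil--McKay cell $D$ if (i) $\{C_1,\dots,C_t\}$ is an equitable partition of the induced subgraph on $V(\Gamma)\setminus D$, and (ii) every $x\in D$ has $0$, $\tfrac12|C_i|$ or $|C_i|$ neighbours in each $C_i$. The switched graph $\mathrm{sw}_\pi\Gamma$ is obtained from $\Gamma$ by interchanging adjacency and nonadjacency between $x\in D$ and the vertices of $C_i$ whenever $x$ has exactly $\tfrac12|C_i|$ neighbours in $C_i$. The Cartesian product $\Gamma\,\square\,\Delta$ has vertex set $V(\Gamma)\times V(\Delta)$, with $(x,w)\sim(x',w')$ iff ($x\sim x'$ and $w=w'$) or ($x=x'$ and $w\sim w'$). The Hamming graph $H(d,q)$ is the Cartesian product of $d$ copies of the complete graph $K_q$. Writing $V(H(2,4))=[4]\times[4]$ and $C=\{(x,x)\mid x\in[4]\}$,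 the partition $\{C,V(H(2,4))\setminus C\}$ is a Godsil--McKay partition with Godsil--McKay cell $V(H(2,4))\setminus C$; the resulting switched graph is the Shrikhande graph $Sh$. The Doob graph $D(m,n)$ is the Cartesian product of $m$ copies of $Sh$ and $n$ copies of $K_4$. *)

theory Defs
  imports "Graph_Theory.Graph_Theory" "HOL-Library.Disjoint_Sets"
begin

text \<open>
  Finite simple graphs are \<^const>\<open>pair_graph\<close>s: an undirected edge is a pair of opposite arcs.
\<close>

definition num_nbrs :: "('a,'b) pre_digraph \<Rightarrow> 'a \<Rightarrow> 'a set \<Rightarrow> nat" where
  "num_nbrs G x C = card {y \<in> C. x \<rightarrow>\<^bsub>G\<^esub> y}"

definition equitable_partition :: "('a,'b) pre_digraph \<Rightarrow> 'a set set \<Rightarrow> bool" where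
  "equitable_partition G P \<longleftrightarrow> partition_on (verts G) P \<and>
     (\<forall>C\<in>P. \<forall>C'\<in>P. \<forall>x\<in>C. \<forall>y\<in>C. num_nbrs G x C' = num_nbrs G y C')"

text \<open>
  A partition with a distinguished cell is given by the set \<open>\<C>\<close> of the other cells and
  the distinguished cell \<open>D\<close>.  All cells, including \<open>D\<close>, are nonempty, and there is at least one
  cell besides \<open>D\<close>.
\<close>

definition gm_partition :: "'a pair_pre_digraph \<Rightarrow> 'a set set \<Rightarrow> 'a set \<Rightarrow> bool" where
  "gm_partition G \<C> D \<longleftrightarrow>
     partition_on (pverts G) (insert D \<C>) \<and> D \<notin> \<C> \<and> \<C> \<noteq> {} \<and>
     equitable_partition (with_proj G \<restriction> (pverts G - D)) \<C> \<and>
     (\<forall>x\<in>D. \<forall>C\<in>\<C>. num_nbrs G x C = 0 \<or> 2 * num_nbrs G x C = card C \<or> num_nbrs G x C = card C)"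

definition gm_switch :: "'a pair_pre_digraph \<Rightarrow> 'a set set \<Rightarrow> 'a set \<Rightarrow> 'a pair_pre_digraph" where
  "gm_switch G \<C> D =
     (let S = {(x, y). x \<in> D \<and> (\<exists>C\<in>\<C>. y \<in> C \<and> 2 * num_nbrs G x C = card C)};
          T = S \<union> S\<inverse>
      in \<lparr> pverts = pverts G, parcs = (parcs G - T) \<union> (T - parcs G) \<rparr>)"

definition cart_prod ::
  "'a pair_pre_digraph \<Rightarrow> 'b pair_pre_digraph \<Rightarrow> ('a \<times> 'b) pair_pre_digraph" (infixr \<open>\<box>\<close> 70) where
  "G \<box> H =
     \<lparr> pverts = pverts G \<times> pverts H,
       parcs = {((x, w), (x', w')) | x w x' w'.
         (x, w) \<in> pverts G \<times> pverts H \<and> (x', w') \<in> pverts G \<times> pverts H \<and>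
         ((x, x') \<in> parcs G \<and> w = w' \<or> x = x' \<and> (w, w') \<in> parcs H)} \<rparr>"

definition relabel :: "('a \<Rightarrow> 'b) \<Rightarrow> 'a pair_pre_digraph \<Rightarrow> 'b pair_pre_digraph" where
  "relabel f G = \<lparr> pverts = f ` pverts G, parcs = map_prod f f ` parcs G \<rparr>"

text \<open>
  The Cartesian product of \<open>d\<close> copies of a graph, with tuples represented as lists of length \<open>d\<close>.
  The empty product is the one-vertex graph.
\<close>

primrec cart_power :: "'a pair_pre_digraph \<Rightarrow> nat \<Rightarrow> 'a list pair_pre_digraph" where
  "cart_power G 0 = \<lparr> pverts = {[]}, parcs = {} \<rparr>"
| "cart_power G (Suc d) = relabel (\<lambda>(x, xs). x # xs) (G \<box> cart_power G d)"

definition complete_graph :: "nat \<Rightarrow> nat pair_pre_digraph" where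
  "complete_graph q = \<lparr> pverts = {1..q}, parcs = {(i, j). i \<in> {1..q} \<and> j \<in> {1..q} \<and> i \<noteq> j} \<rparr>"

definition hamming_graph :: "nat \<Rightarrow> nat \<Rightarrow> nat list pair_pre_digraph" where
  "hamming_graph d q = cart_power (complete_graph q) d"

definition diagonal :: "nat list set" where
  "diagonal = {[x, x] | x. x \<in> {1..4}}"

definition shrikhande_graph :: "nat list pair_pre_digraph" where
  "shrikhande_graph =
     gm_switch (hamming_graph 2 4) {diagonal} (pverts (hamming_graph 2 4) - diagonal)"

definition doob_graph :: "nat \<Rightarrow> nat \<Rightarrow> (nat list list \<times> nat list) pair_pre_digraph" where
  "doob_graph m n = cart_power shrikhande_graph m \<box> cart_power (complete_graph 4) n"

lemma complete_graph_complete: "K\<^bsub>q\<^esub> (with_proj (complete_graph q))"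
  unfolding complete_digraph_pair_def by (auto simp: complete_graph_def)

lemma pverts_hamming_2_4: "pverts (hamming_graph 2 4) = {[x, y] | x y. x \<in> {1..4} \<and> y \<in> {1..4}}"
  by (auto simp: hamming_graph_def numeral_2_eq_2 relabel_def cart_prod_def complete_graph_def
      image_iff)

lemma parcs_hamming_2_4:
  "([x, y], [x', y']) \<in> parcs (hamming_graph 2 4) \<longleftrightarrow>
     {x, y, x', y'} \<subseteq> {1..4} \<and> (x \<noteq> x' \<and> y = y' \<or> x = x' \<and> y \<noteq> y')"
  by (auto simp: hamming_graph_def numeral_2_eq_2 relabel_def cart_prod_def complete_graph_def
      image_iff map_prod_def split: prod.splits)

lemma gm_partition_diagonal:
  "gm_partition (hamming_graph 2 4) {diagonal} (pverts (hamming_graph 2 4) - diagonal)"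
proof -
  let ?G = "hamming_graph 2 4"
  have sub: "diagonal \<subseteq> pverts ?G"
    by (auto simp: diagonal_def pverts_hamming_2_4)
  have ne: "[1, 1] \<in> diagonal"
    by (auto simp: diagonal_def)
  have "[1, 2] \<in> pverts ?G - diagonal"
    by (auto simp: diagonal_def pverts_hamming_2_4)
  then have ne': "pverts ?G - diagonal \<noteq> {}" by blast
  have part: "partition_on (pverts ?G) {pverts ?G - diagonal, diagonal}"
    using sub ne ne' by (auto simp: partition_on_def disjoint_def)
  have diff: "pverts ?G - (pverts ?G - diagonal) = diagonal"
    using sub by blast
  have coclique: "(u, v) \<notin> parcs ?G" if "u \<in> diagonal" "v \<in> diagonal" for u v
    using that by (auto simp: diagonal_def parcs_hamming_2_4)
  have equitable: "equitable_partition (with_proj ?G \<restriction> diagonal) {diagonal}"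
    using ne coclique
    by (auto simp: equitable_partition_def partition_on_def num_nbrs_def disjoint_def
        arcs_ends_def arc_to_ends_def intro!: arg_cong[where f = card])
  have card_diag: "card diagonal = 4"
  proof -
    have "diagonal = (\<lambda>x. [x, x]) ` {1..4}" by (auto simp: diagonal_def)
    moreover have "inj_on (\<lambda>x::nat. [x, x]) {1..4}" by (simp add: inj_on_def)
    ultimately show ?thesis using card_image by fastforce
  qed
  have half: "num_nbrs ?G u diagonal = 2" if u: "u \<in> pverts ?G - diagonal" for u
  proof -
    obtain x y where xy: "u = [x, y]" "x \<in> {1..4}" "y \<in> {1..4}" "x \<noteq> y"
      using u by (auto simp: pverts_hamming_2_4 diagonal_def)
    then have "{v \<in> diagonal. (u, v) \<in> parcs ?G} = {[x, x], [y, y]}"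
      by (auto simp: diagonal_def parcs_hamming_2_4)
    with xy show ?thesis by (simp add: num_nbrs_def)
  qed
  show ?thesis
    unfolding gm_partition_def diff
    using part equitable card_diag half ne by auto
qed

end

theory Submission
  imports Defs
begin

text \<open>
  A Godsil--McKay partition \<open>{C\<^sub>1, \<dots>, C\<^sub>t, D}\<close> of \<open>H\<close> lifts to \<open>G \<box> H\<close>: the cells are the sets
  \<open>{x} \<times> C\<^sub>i\<close>, and \<open>V(G) \<times> D\<close> is the Godsil--McKay cell.  A vertex \<open>(x, w)\<close> with \<open>w \<in> D\<close> has no
  neighbours in \<open>{x'} \<times> C\<^sub>i\<close> unless \<open>x = x'\<close>, so switching \<open>G \<box> H\<close> amounts to switching \<open>H\<close>.
  Applied to two coordinates at a time, this replaces the factors \<open>H(2,4)\<close> of the Hamming graph by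
  Shrikhande graphs one after the other.
\<close>

section \<open>Relabelling and Cartesian products\<close>

text \<open>The arc set inherits finiteness from \<open>pverts G \<times> pverts G\<close>. What
  remains are set-level conditions that can be checked directly for each construction.\<close>

lemma pair_graph_iff:
  "pair_graph G \<longleftrightarrow> finite (pverts G) \<and> parcs G \<subseteq> pverts G \<times> pverts G \<and>
     sym (parcs G) \<and> irrefl (parcs G)"
proof
  assume "pair_graph G"
  then interpret pair_graph G .
  show "finite (pverts G) \<and> parcs G \<subseteq> pverts G \<times> pverts G \<and> sym (parcs G) \<and> irrefl (parcs G)"
    using pair_finite_verts pair_no_loops[of "(a, a)" for a] pair_sym_arcs in_arcsD1 in_arcsD2
    by (auto simp: symmetric_def irrefl_def)
next
  assume *: "finite (pverts G) \<and> parcs G \<subseteq> pverts G \<times> pverts G \<and> sym (parcs G) \<and> irrefl (parcs G)"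
  moreover have "finite (parcs G)"
    using * by (meson finite_SigmaI finite_subset)
  ultimately show "pair_graph G"
    by unfold_locales (auto simp: symmetric_def irrefl_def)
qed

lemma pair_graph_eqI:
  fixes G H :: "'a pair_pre_digraph"
  assumes "pverts G = pverts H" "\<And>u v. (u, v) \<in> parcs G \<longleftrightarrow> (u, v) \<in> parcs H"
  shows "G = H"
  using assms by (intro pair_pre_digraph.equality) auto

lemma pair_graph_arcs_subset: "pair_graph G \<Longrightarrow> parcs G \<subseteq> pverts G \<times> pverts G"
  by (simp add: pair_graph_iff)

lemma pverts_relabel [simp]: "pverts (relabel f G) = f ` pverts G"
  by (simp add: relabel_def)

lemma parcs_relabel: "parcs (relabel f G) = map_prod f f ` parcs G"
  by (simp add: relabel_def)

lemma in_parcs_relabel_iff: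
  "(u, v) \<in> parcs (relabel f G) \<longleftrightarrow> (\<exists>a b. (a, b) \<in> parcs G \<and> u = f a \<and> v = f b)"
  by (force simp: parcs_relabel)

lemma in_parcs_relabel_inj:
  assumes "inj_on f (pverts G)" "parcs G \<subseteq> pverts G \<times> pverts G" "u \<in> pverts G" "v \<in> pverts G"
  shows "(f u, f v) \<in> parcs (relabel f G) \<longleftrightarrow> (u, v) \<in> parcs G"
  unfolding in_parcs_relabel_iff using assms by (blast dest: inj_onD)

lemma pverts_cart_prod [simp]: "pverts (G \<box> H) = pverts G \<times> pverts H"
  by (simp add: cart_prod_def)

lemma in_parcs_cart_prod_iff:
  "((x, w), (x', w')) \<in> parcs (G \<box> H) \<longleftrightarrow>
     x \<in> pverts G \<and> w \<in> pverts H \<and> x' \<in> pverts G \<and> w' \<in> pverts H \<and>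
     ((x, x') \<in> parcs G \<and> w = w' \<or> x = x' \<and> (w, w') \<in> parcs H)"
  by (auto simp: cart_prod_def)

lemma pair_graph_relabel:
  assumes "pair_graph G" "inj_on f (pverts G)"
  shows "pair_graph (relabel f G)"
proof -
  have wf: "parcs G \<subseteq> pverts G \<times> pverts G" and sym: "sym (parcs G)" and irr: "irrefl (parcs G)"
    and fin: "finite (pverts G)"
    using assms(1) by (auto simp: pair_graph_iff)
  have "parcs (relabel f G) \<subseteq> pverts (relabel f G) \<times> pverts (relabel f G)"
    using wf by (auto simp: parcs_relabel)
  moreover have "sym (parcs (relabel f G))"
    using sym unfolding sym_def in_parcs_relabel_iff by blast
  moreover have "irrefl (parcs (relabel f G))"
    using irr wf assms(2) unfolding irrefl_def in_parcs_relabel_iff by (auto dest: inj_onD)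
  ultimately show ?thesis using fin by (simp add: pair_graph_iff)
qed

lemma pair_graph_cart_prod:
  assumes "pair_graph G" "pair_graph H"
  shows "pair_graph (G \<box> H)"
  using assms unfolding pair_graph_iff
  by (auto simp: in_parcs_cart_prod_iff sym_def irrefl_def)

lemma relabel_relabel: "relabel f (relabel g G) = relabel (f \<circ> g) G"
  by (simp add: relabel_def image_comp prod.map_comp)

lemma relabel_cong:
  assumes "\<And>x. x \<in> pverts G \<Longrightarrow> f x = g x" "parcs G \<subseteq> pverts G \<times> pverts G"
  shows "relabel f G = relabel g G"
  using assms unfolding relabel_def by (auto intro!: image_cong)

text \<open>Relabellings can be moved out of products, so that nested constructions collapse to one
  relabelling of one product. The inclusion places the end points of every arc of \<open>G\<close>
  in \<open>pverts G\<close>, as arcs of the product on the right require.\<close>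

lemma cart_prod_relabel_left:
  assumes "parcs G \<subseteq> pverts G \<times> pverts G"
  shows "relabel f G \<box> H = relabel (map_prod f id) (G \<box> H)"
  using assms
  by (intro pair_graph_eqI; auto simp: in_parcs_relabel_iff in_parcs_cart_prod_iff image_iff)
    blast+

lemma cart_prod_relabel_right:
  assumes "parcs H \<subseteq> pverts H \<times> pverts H"
  shows "G \<box> relabel f H = relabel (map_prod id f) (G \<box> H)"
  using assms
  by (intro pair_graph_eqI; auto simp: in_parcs_relabel_iff in_parcs_cart_prod_iff image_iff)
    blast+

lemma cart_prod_assoc: "(G \<box> H) \<box> K = relabel (\<lambda>(x, y, z). ((x, y), z)) (G \<box> H \<box> K)"
  by (intro pair_graph_eqI)
    (auto simp: in_parcs_relabel_iff in_parcs_cart_prod_iff image_iff)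

lemma cart_prod_commute: "G \<box> H = relabel prod.swap (H \<box> G)"
  by (intro pair_graph_eqI)
    (auto simp: in_parcs_relabel_iff in_parcs_cart_prod_iff image_iff)

section \<open>Isomorphisms given by injective relabellings\<close>

lemma digraph_iso_relabel:
  assumes "pair_graph G" "inj_on f (pverts G)"
  shows "digraph_iso (with_proj G) (with_proj (relabel f G))"
proof -
  \<comment> \<open>Arcs are pairs of vertices, so \<open>f\<close> determines the arc map, and the
    new head and tail are again the projections; \<open>app_iso\<close> then yields the relabelled
    graph literally.\<close>
  let ?h = "\<lparr>iso_verts = f, iso_arcs = map_prod f f, iso_head = snd, iso_tail = fst\<rparr>"
  interpret pair_graph G by fact
  have "inj_on (map_prod f f) (parcs G)"
    using map_prod_inj_on[OF assms(2) assms(2)] pair_graph_arcs_subset[OF assms(1)]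
    by (rule inj_on_subset)
  then have "pre_digraph.digraph_isomorphism (with_proj G) ?h"
    using assms(2) wf_digraph by (auto simp: pre_digraph.digraph_isomorphism_def)
  moreover have "with_proj (relabel f G) = app_iso ?h (with_proj G)"
    by (simp add: app_iso_def with_proj_def relabel_def)
  ultimately show ?thesis unfolding digraph_iso_def by blast
qed

lemma relabel_id [simp]: "relabel id (G :: 'a pair_pre_digraph) = G"
  by (intro pair_graph_eqI) (auto simp: in_parcs_relabel_iff)

text \<open>The inverse of \<open>f\<close> on \<open>pverts G\<close> is itself an injective
  relabelling, and it carries \<open>relabel f G\<close> back to \<open>G\<close>.\<close>

lemma digraph_iso_relabel_sym:
  assumes "pair_graph G" "inj_on f (pverts G)"
  shows "digraph_iso (with_proj (relabel f G)) (with_proj G)"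
proof -
  let ?g = "the_inv_into (pverts G) f"
  have "relabel ?g (relabel f G) = relabel id G"
    unfolding relabel_relabel using assms
    by (intro relabel_cong) (auto simp: the_inv_into_f_f pair_graph_arcs_subset)
  then show ?thesis
    using digraph_iso_relabel[OF pair_graph_relabel[OF assms], of ?g] assms(2)
    by (simp add: inj_on_the_inv_into)
qed

section \<open>Godsil--McKay switching of products\<close>

text \<open>The cells in \<open>\<C>\<close> avoid \<open>D\<close>, so for vertices outside
  \<open>D\<close> the neighbours in a cell are the same in \<open>G\<close> and in the induced
  subgraph. Equitability can therefore be tested in \<open>G\<close> itself.\<close>

lemma gm_partition_iff:
  "gm_partition G \<C> D \<longleftrightarrow>
     partition_on (pverts G) (insert D \<C>) \<and> D \<notin> \<C> \<and> \<C> \<noteq> {} \<and>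
     (\<forall>C\<in>\<C>. \<forall>C'\<in>\<C>. \<forall>x\<in>C. \<forall>y\<in>C. num_nbrs G x C' = num_nbrs G y C') \<and>
     (\<forall>x\<in>D. \<forall>C\<in>\<C>. num_nbrs G x C = 0 \<or> 2 * num_nbrs G x C = card C \<or> num_nbrs G x C = card C)"
proof (cases "partition_on (pverts G) (insert D \<C>) \<and> D \<notin> \<C>")
  case True
  then have sub: "\<Union>\<C> \<subseteq> pverts G - D" and part: "partition_on (pverts G - D) \<C>"
    by (auto simp: partition_on_def disjoint_def)
  have "num_nbrs (with_proj G \<restriction> (pverts G - D)) x C = num_nbrs G x C"
    if "x \<in> C'" "C' \<in> \<C>" "C \<in> \<C>" for x C C'
    using sub that
    by (auto simp: num_nbrs_def arcs_ends_conv intro!: arg_cong[where f = card])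
  then show ?thesis
    using True part unfolding gm_partition_def equitable_partition_def by simp
qed (auto simp: gm_partition_def)

lemma pverts_gm_switch [simp]: "pverts (gm_switch G \<C> D) = pverts G"
  by (simp add: gm_switch_def Let_def)

text \<open>The set \<open>S\<close> in \<open>gm_switch\<close>, oriented from \<open>D\<close> to
  the other cells. It is named because transporting a switch amounts to computing this set for the
  new graph.\<close>

definition half_pairs :: "'a pair_pre_digraph \<Rightarrow> 'a set set \<Rightarrow> 'a set \<Rightarrow> 'a rel" where
  "half_pairs G \<C> D = {(x, y). x \<in> D \<and> (\<exists>C\<in>\<C>. y \<in> C \<and> 2 * num_nbrs G x C = card C)}"

lemma parcs_gm_switch:
  "parcs (gm_switch G \<C> D) =
     (parcs G - (half_pairs G \<C> D \<union> (half_pairs G \<C> D)\<inverse>)) \<union>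
     ((half_pairs G \<C> D \<union> (half_pairs G \<C> D)\<inverse>) - parcs G)"
  by (simp add: gm_switch_def Let_def half_pairs_def)

lemma half_pairs_subset:
  assumes "gm_partition G \<C> D"
  shows "half_pairs G \<C> D \<subseteq> D \<times> \<Union>\<C>" "D \<subseteq> pverts G" "\<Union>\<C> \<subseteq> pverts G" "D \<inter> \<Union>\<C> = {}"
  using assms by (auto simp: half_pairs_def gm_partition_def partition_on_def disjoint_def)

text \<open>Only pairs between \<open>D\<close> and its complement change, so no loops arise, and
  they change in both orientations, so symmetry survives.\<close>

lemma pair_graph_gm_switch:
  assumes "pair_graph G" "gm_partition G \<C> D"
  shows "pair_graph (gm_switch G \<C> D)"
proof -
  note hp = half_pairs_subset[OF assms(2)]
  show ?thesis
    using assms(1) hp unfolding pair_graph_iff parcs_gm_switch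
    by (auto simp: sym_def irrefl_def)
qed

text \<open>Equality, not isomorphism, with the switched graph lets a step be carried through
  relabellings and products by rewriting.\<close>

definition gm_switches_to :: "'a pair_pre_digraph \<Rightarrow> 'a pair_pre_digraph \<Rightarrow> bool" where
  "gm_switches_to G G' \<longleftrightarrow> (\<exists>\<C> D. gm_partition G \<C> D \<and> G' = gm_switch G \<C> D)"

lemma gm_switches_toD:
  assumes "gm_switches_to G G'"
  shows "pverts G' = pverts G" "pair_graph G \<Longrightarrow> pair_graph G'"
  using assms by (auto simp: gm_switches_to_def pair_graph_gm_switch)

section \<open>Transport of switching along injective relabellings\<close>

lemma num_nbrs_relabel:
  assumes "inj_on f (pverts G)" "parcs G \<subseteq> pverts G \<times> pverts G" "x \<in> pverts G" "C \<subseteq> pverts G"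
  shows "num_nbrs (relabel f G) (f x) (f ` C) = num_nbrs G x C"
proof -
  have "{y \<in> f ` C. (f x, y) \<in> parcs (relabel f G)} = f ` {y \<in> C. (x, y) \<in> parcs G}"
    using assms in_parcs_relabel_inj[OF assms(1,2)] by blast
  moreover have "inj_on f {y \<in> C. (x, y) \<in> parcs G}"
    using assms by (auto intro: inj_on_subset)
  ultimately show ?thesis
    by (simp add: num_nbrs_def card_image)
qed

text \<open>Neighbour counts and cell sizes are invariant under an injective relabelling, so the
  image partition is again Godsil--McKay and its half pairs are the images of the old ones.\<close>

lemma gm_switches_to_relabel:
  assumes "gm_switches_to G G'" "pair_graph G" "inj_on f (pverts G)"
  shows "gm_switches_to (relabel f G) (relabel f G')"
proof -
  obtain \<C> D where gm: "gm_partition G \<C> D" and G': "G' = gm_switch G \<C> D"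
    using assms(1) by (auto simp: gm_switches_to_def)
  note wf = pair_graph_arcs_subset[OF assms(2)]
  note hp = half_pairs_subset[OF gm]
  have subC: "C \<subseteq> pverts G" if "C \<in> \<C>" for C using hp that by blast
  have num: "num_nbrs (relabel f G) (f x) (f ` C) = num_nbrs G x C"
    if "x \<in> pverts G" "C \<in> \<C>" for x C
    using num_nbrs_relabel[OF assms(3) wf that(1) subC[OF that(2)]] .
  have crd: "card (f ` C) = card C" if "C \<in> \<C>" for C
    using assms(3) subC[OF that] by (meson card_image inj_on_subset)
  have part: "partition_on (pverts G) (insert D \<C>)" and D: "D \<notin> \<C>"
    using gm by (auto simp: gm_partition_def)
  have fD: "f ` D \<noteq> f ` C" if "C \<in> \<C>" for C
    using D that inj_on_image_eq_iff[OF assms(3) hp(2) subC[OF that]] by auto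
  have "gm_partition (relabel f G) ((`) f ` \<C>) (f ` D)"
    unfolding gm_partition_iff
  proof (intro conjI)
    \<comment> \<open>\<open>partition_on_inj_image\<close> discards an empty image cell; since no
      cell is empty, nothing is discarded here.\<close>
    have "{} \<notin> (`) f ` insert D \<C>"
      using partition_onD3[OF part] by auto
    then have "(`) f ` insert D \<C> - {{}} = insert (f ` D) ((`) f ` \<C>)"
      by simp
    then show "partition_on (pverts (relabel f G)) (insert (f ` D) ((`) f ` \<C>))"
      using partition_on_inj_image[OF part assms(3)] by simp
    show "f ` D \<notin> (`) f ` \<C>" using fD by blast
    show "(`) f ` \<C> \<noteq> {}" using gm by (simp add: gm_partition_def)
    have "num_nbrs (relabel f G) (f x) (f ` C') = num_nbrs (relabel f G) (f y) (f ` C')"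
      if "C \<in> \<C>" "C' \<in> \<C>" "x \<in> C" "y \<in> C" for C C' x y
    proof -
      have "x \<in> pverts G" "y \<in> pverts G" using subC that by auto
      moreover have "num_nbrs G x C' = num_nbrs G y C'"
        using gm that unfolding gm_partition_iff by blast
      ultimately show ?thesis using that by (simp add: num)
    qed
    then show "\<forall>C\<in>(`) f ` \<C>. \<forall>C'\<in>(`) f ` \<C>. \<forall>x\<in>C. \<forall>y\<in>C.
        num_nbrs (relabel f G) x C' = num_nbrs (relabel f G) y C'"
      by (intro ballI) (elim imageE, hypsubst, blast)
    show "\<forall>x\<in>f ` D. \<forall>C\<in>(`) f ` \<C>. num_nbrs (relabel f G) x C = 0 \<or>
        2 * num_nbrs (relabel f G) x C = card C \<or> num_nbrs (relabel f G) x C = card C"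
      using gm hp(2) unfolding gm_partition_iff by (simp add: num crd subset_iff)
  qed
  moreover have "relabel f G' = gm_switch (relabel f G) ((`) f ` \<C>) (f ` D)"
  proof (rule pair_pre_digraph.equality)
    let ?T = "half_pairs G \<C> D \<union> (half_pairs G \<C> D)\<inverse>"
    have half: "half_pairs (relabel f G) ((`) f ` \<C>) (f ` D) = map_prod f f ` half_pairs G \<C> D"
    proof -
      have "2 * num_nbrs (relabel f G) (f x) (f ` C) = card (f ` C) \<longleftrightarrow> 2 * num_nbrs G x C = card C"
        if "x \<in> D" "C \<in> \<C>" for x C
        using that hp(2) by (simp add: num crd subsetD)
      then have *: "(f x, f y) \<in> half_pairs (relabel f G) ((`) f ` \<C>) (f ` D) \<longleftrightarrow> (x, y) \<in> half_pairs G \<C> D"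
        if "x \<in> pverts G" "y \<in> pverts G" for x y
        using that assms(3) hp(2) subC
        by (simp add: half_pairs_def inj_on_image_mem_iff[OF assms(3)] cong: conj_cong)
      show ?thesis
      proof (intro equalityI subrelI)
        fix a b assume ab: "(a, b) \<in> half_pairs (relabel f G) ((`) f ` \<C>) (f ` D)"
        then have "a \<in> f ` pverts G" "b \<in> f ` pverts G"
          using hp(2) subC unfolding half_pairs_def by blast+
        then obtain x y where "x \<in> pverts G" "y \<in> pverts G" "a = f x" "b = f y" by blast
        then show "(a, b) \<in> map_prod f f ` half_pairs G \<C> D" using ab * by auto
      next
        fix a b assume "(a, b) \<in> map_prod f f ` half_pairs G \<C> D"
        then obtain x y where "(x, y) \<in> half_pairs G \<C> D" "a = f x" "b = f y" by auto
        moreover from this have "x \<in> pverts G" "y \<in> pverts G" using hp(1-3) by blast+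
        ultimately show "(a, b) \<in> half_pairs (relabel f G) ((`) f ` \<C>) (f ` D)" using * by simp
      qed
    qed
    have T: "map_prod f f ` half_pairs G \<C> D \<union> (map_prod f f ` half_pairs G \<C> D)\<inverse> = map_prod f f ` ?T"
      by auto
    \<comment> \<open>Injectivity on all vertex pairs makes the image commute with the two set
      differences in \<open>parcs_gm_switch\<close>.\<close>
    have inj: "inj_on (map_prod f f) (pverts G \<times> pverts G)"
      using assms(3) by (rule map_prod_inj_on) (rule assms(3))
    have sub: "?T \<subseteq> pverts G \<times> pverts G" using hp by blast
    show "parcs (relabel f G') = parcs (gm_switch (relabel f G) ((`) f ` \<C>) (f ` D))"
      unfolding G' parcs_gm_switch parcs_relabel half T
      using wf sub by (subst image_Un, subst (1 2) inj_on_image_set_diff[OF inj]) auto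
  qed (auto simp: G')
  ultimately show ?thesis by (auto simp: gm_switches_to_def)
qed

section \<open>Lifting a switch to a Cartesian product\<close>

text \<open>An arc of the product moves in exactly one coordinate. Within the copy of
  \<open>H\<close> over \<open>x\<close> it moves in \<open>H\<close>, since \<open>G\<close> has no
  loops; towards another copy it must keep \<open>w\<close>, which leaves at most one
  neighbour.\<close>

lemma num_nbrs_cart_prod:
  assumes "pair_graph G" "x \<in> pverts G" "x' \<in> pverts G" "w \<in> pverts H" "C \<subseteq> pverts H"
  shows "num_nbrs (G \<box> H) (x, w) ({x'} \<times> C) =
    (if x = x' then num_nbrs H w C else if (x, x') \<in> parcs G \<and> w \<in> C then 1 else 0)"
proof -
  have irr: "(x, x) \<notin> parcs G" using assms(1) by (auto simp: pair_graph_iff irrefl_def)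
  have "{y \<in> {x'} \<times> C. ((x, w), y) \<in> parcs (G \<box> H)} =
      {x'} \<times> (if x = x' then {w' \<in> C. (w, w') \<in> parcs H} else if (x, x') \<in> parcs G \<and> w \<in> C then {w} else {})"
    using irr assms(2-5) by (auto simp: in_parcs_cart_prod_iff subset_iff)
  then show ?thesis by (simp add: num_nbrs_def card_cartesian_product)
qed

text \<open>The half pairs of the lifted partition are those of \<open>H\<close> repeated in each
  copy of \<open>H\<close>, so switching affects only the arcs coming from \<open>H\<close>. A
  vertex of \<open>G\<close> is needed for \<open>D'\<close> to be nonempty and for a further cell
  to exist.\<close>

lemma gm_switches_to_cart_prod_right:
  assumes "gm_switches_to H H'" "pair_graph G" "pair_graph H" "pverts G \<noteq> {}"
  shows "gm_switches_to (G \<box> H) (G \<box> H')"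
proof -
  obtain \<C> D where gm: "gm_partition H \<C> D" and H': "H' = gm_switch H \<C> D"
    using assms(1) by (auto simp: gm_switches_to_def)
  note hp = half_pairs_subset[OF gm]
  define \<C>' where "\<C>' = {{x} \<times> C | x C. x \<in> pverts G \<and> C \<in> \<C>}"
  define D' where "D' = pverts G \<times> D"
  have subC: "C \<subseteq> pverts H" if "C \<in> \<C>" for C using hp that by blast
  have num: "num_nbrs (G \<box> H) (x, w) ({x'} \<times> C) =
      (if x = x' then num_nbrs H w C else if (x, x') \<in> parcs G \<and> w \<in> C then 1 else 0)"
    if "x \<in> pverts G" "x' \<in> pverts G" "w \<in> pverts H" "C \<in> \<C>" for x x' w C
    using num_nbrs_cart_prod[OF assms(2) that(1-3) subC[OF that(4)]] .
  have part: "partition_on (pverts H) (insert D \<C>)" and "D \<notin> \<C>" "\<C> \<noteq> {}"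
    using gm by (auto simp: gm_partition_def)
  then have ne: "D \<noteq> {}" "\<And>C. C \<in> \<C> \<Longrightarrow> C \<noteq> {}" and cover: "D \<union> \<Union>\<C> = pverts H"
    and disj: "\<And>C C'. C \<in> \<C> \<Longrightarrow> C' \<in> \<C> \<Longrightarrow> C \<noteq> C' \<Longrightarrow> C \<inter> C' = {}"
    by (auto simp: partition_on_def disjoint_def)
  \<comment> \<open>With a positive cell size, a count of 0 is never half of it; this keeps pairs
    with different first coordinates from being switched.\<close>
  have pos: "card C > 0" if "C \<in> \<C>" for C
    using ne(2)[OF that] subC[OF that] assms(3) by (auto simp: pair_graph_iff card_gt_0_iff finite_subset)
  have notin: "w \<notin> C" if "w \<in> D" "C \<in> \<C>" for w C using hp(4) that by blast
  have "gm_partition (G \<box> H) \<C>' D'"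
    unfolding gm_partition_iff
  proof (intro conjI)
    show "partition_on (pverts (G \<box> H)) (insert D' \<C>')"
    proof (rule partition_onI)
      show "\<Union> (insert D' \<C>') = pverts (G \<box> H)"
        using cover by (auto simp: D'_def \<C>'_def)
      show "{} \<notin> insert D' \<C>'"
        using ne assms(4) by (auto simp: D'_def \<C>'_def)
      show "disjnt p q" if "p \<in> insert D' \<C>'" "q \<in> insert D' \<C>'" "p \<noteq> q" for p q
        using that notin disj by (auto simp: D'_def \<C>'_def disjnt_def) blast+
    qed
    show "D' \<notin> \<C>'"
      using ne notin assms(4) by (auto simp: D'_def \<C>'_def) blast
    show "\<C>' \<noteq> {}"
      using \<open>\<C> \<noteq> {}\<close> assms(4) by (auto simp: \<C>'_def)
    have "num_nbrs (G \<box> H) (x, w) ({x'} \<times> C') = num_nbrs (G \<box> H) (x, v) ({x'} \<times> C')"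
      if "x \<in> pverts G" "x' \<in> pverts G" "C \<in> \<C>" "C' \<in> \<C>" "w \<in> C" "v \<in> C" for x x' C C' w v
    proof -
      have "num_nbrs H w C' = num_nbrs H v C'"
        using gm that unfolding gm_partition_iff by blast
      \<comment> \<open>For adjacent \<open>x\<close> and \<open>x'\<close> the count is 1 or 0
        according to membership in \<open>C'\<close>, which two vertices of one cell share because
        the cells are disjoint.\<close>
      moreover have "w \<in> C' \<longleftrightarrow> v \<in> C'" using disj that by blast
      ultimately show ?thesis using that subC[OF that(3)] by (simp add: num subsetD)
    qed
    then show "\<forall>C\<in>\<C>'. \<forall>C'\<in>\<C>'. \<forall>x\<in>C. \<forall>y\<in>C. num_nbrs (G \<box> H) x C' = num_nbrs (G \<box> H) y C'"
      unfolding \<C>'_def by blast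
    have "num_nbrs H w C = 0 \<or> 2 * num_nbrs H w C = card C \<or> num_nbrs H w C = card C"
      if "w \<in> D" "C \<in> \<C>" for w C
      using gm that unfolding gm_partition_iff by blast
    then show "\<forall>x\<in>D'. \<forall>C\<in>\<C>'. num_nbrs (G \<box> H) x C = 0 \<or>
        2 * num_nbrs (G \<box> H) x C = card C \<or> num_nbrs (G \<box> H) x C = card C"
      using hp(2) by (auto simp: D'_def \<C>'_def num subset_iff notin card_cartesian_product)
        (metis neq0_conv)
  qed
  moreover have "G \<box> H' = gm_switch (G \<box> H) \<C>' D'"
  proof (rule pair_pre_digraph.equality)
    have half: "((x, w), (x', w')) \<in> half_pairs (G \<box> H) \<C>' D' \<longleftrightarrow>
        x \<in> pverts G \<and> x = x' \<and> (w, w') \<in> half_pairs H \<C> D" for x w x' w'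
    proof
      assume "((x, w), (x', w')) \<in> half_pairs (G \<box> H) \<C>' D'"
      then obtain C where *: "x \<in> pverts G" "w \<in> D" "x' \<in> pverts G" "C \<in> \<C>" "w' \<in> C"
        "2 * num_nbrs (G \<box> H) (x, w) ({x'} \<times> C) = card ({x'} \<times> C)"
        by (auto simp: half_pairs_def D'_def \<C>'_def)
      then show "x \<in> pverts G \<and> x = x' \<and> (w, w') \<in> half_pairs H \<C> D"
        using hp(2) notin[OF *(2,4)] pos[OF *(4)]
        by (auto simp: num subsetD card_cartesian_product half_pairs_def split: if_splits)
    next
      assume *: "x \<in> pverts G \<and> x = x' \<and> (w, w') \<in> half_pairs H \<C> D"
      then obtain C where C: "w \<in> D" "C \<in> \<C>" "w' \<in> C" "2 * num_nbrs H w C = card C"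
        by (auto simp: half_pairs_def)
      then have "2 * num_nbrs (G \<box> H) (x, w) ({x} \<times> C) = card ({x} \<times> C)"
        using * subsetD[OF hp(2)] by (auto simp: num card_cartesian_product)
      then show "((x, w), (x', w')) \<in> half_pairs (G \<box> H) \<C>' D'"
        using * C by (auto simp: half_pairs_def D'_def \<C>'_def)
    qed
    \<comment> \<open>Switched pairs have equal first coordinates, so by irreflexivity none of them
      is an arc coming from \<open>G\<close>.\<close>
    have irr: "(x, x) \<notin> parcs G" for x
      using assms(2) by (auto simp: pair_graph_iff irrefl_def)
    have arcs: "((x, w), (x', w')) \<in> parcs (G \<box> H') \<longleftrightarrow>
        ((x, w), (x', w')) \<in> parcs (gm_switch (G \<box> H) \<C>' D')" for x w x' w'
      unfolding in_parcs_cart_prod_iff parcs_gm_switch Un_iff Diff_iff converse_iff half H'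
        pverts_gm_switch
      using hp irr by auto
    show "parcs (G \<box> H') = parcs (gm_switch (G \<box> H) \<C>' D')"
      using arcs by (intro set_eqI) (metis surj_pair)
  qed (auto simp: H')
  ultimately show ?thesis by (auto simp: gm_switches_to_def)
qed

text \<open>Swapping the coordinates is an injective relabelling that reduces this to switching the
  right factor.\<close>

lemma gm_switches_to_cart_prod_left:
  assumes "gm_switches_to G G'" "pair_graph G" "pair_graph H" "pverts H \<noteq> {}"
  shows "gm_switches_to (G \<box> H) (G' \<box> H)"
  unfolding cart_prod_commute[of _ H]
  using assms
  by (intro gm_switches_to_relabel gm_switches_to_cart_prod_right pair_graph_cart_prod) auto

section \<open>From Hamming graphs to Doob graphs\<close>

lemma pair_graph_cart_power: "pair_graph G \<Longrightarrow> pair_graph (cart_power G d)"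
proof (induction d)
  case 0
  show ?case by (simp add: pair_graph_iff sym_def irrefl_def)
next
  case (Suc d)
  then show ?case
    by (auto intro!: pair_graph_relabel pair_graph_cart_prod simp: inj_on_def)
qed

lemma pverts_cart_power: "pverts (cart_power G d) = {xs. length xs = d \<and> set xs \<subseteq> pverts G}"
  by (induction d) (auto simp: image_iff length_Suc_conv)

section \<open>Products with concatenated coordinates\<close>

text \<open>A Cartesian product that stays within list vertices, so that all graphs of the switching
  sequence can share one type.\<close>

definition append_prod ::
  "'a list pair_pre_digraph \<Rightarrow> 'a list pair_pre_digraph \<Rightarrow> 'a list pair_pre_digraph" where
  "append_prod G H = relabel (\<lambda>(xs, ys). xs @ ys) (G \<box> H)"

text \<open>The common length \<open>l\<close> of the first components tells where to cut a
  concatenation.\<close>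

lemma inj_on_append:
  assumes "\<And>xs. xs \<in> A \<Longrightarrow> length xs = l"
  shows "inj_on (\<lambda>(xs, ys). xs @ ys) (A \<times> B)"
  using assms by (auto simp: inj_on_def)

lemma pair_graph_append_prod:
  assumes "pair_graph G" "pair_graph H" "\<And>xs. xs \<in> pverts G \<Longrightarrow> length xs = l"
  shows "pair_graph (append_prod G H)"
  unfolding append_prod_def using assms
  by (intro pair_graph_relabel pair_graph_cart_prod) (auto intro: inj_on_append)

lemma relabel_singleton_cart_prod:
  assumes "parcs G \<subseteq> pverts G \<times> pverts G" "\<And>y. f (x, y) = y"
  shows "relabel f (\<lparr>pverts = {x}, parcs = {}\<rparr> \<box> G) = G"
proof (rule pair_graph_eqI)
  show "pverts (relabel f (\<lparr>pverts = {x}, parcs = {}\<rparr> \<box> G)) = pverts G"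
    using assms(2) by (auto simp: image_iff)
  show "(u, v) \<in> parcs (relabel f (\<lparr>pverts = {x}, parcs = {}\<rparr> \<box> G)) \<longleftrightarrow> (u, v) \<in> parcs G" for u v
    using assms by (auto simp: in_parcs_relabel_iff in_parcs_cart_prod_iff)
qed

text \<open>In the induction step both sides become relabellings of the same triple product, and the
  two labellings agree because consing commutes with appending on the right.\<close>

lemma cart_power_add:
  assumes "pair_graph G"
  shows "cart_power G (a + b) = append_prod (cart_power G a) (cart_power G b)"
proof (induction a)
  case 0
  show ?case
    using pair_graph_arcs_subset[OF pair_graph_cart_power[OF assms, of b]]
    by (simp add: append_prod_def relabel_singleton_cart_prod)
next
  case (Suc a)
  let ?A = "cart_power G a" and ?B = "cart_power G b"
  have A: "parcs (G \<box> ?A) \<subseteq> pverts (G \<box> ?A) \<times> pverts (G \<box> ?A)"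
    and B: "parcs (?A \<box> ?B) \<subseteq> pverts (?A \<box> ?B) \<times> pverts (?A \<box> ?B)"
    by (intro pair_graph_arcs_subset pair_graph_cart_prod pair_graph_cart_power assms)+
  show ?case
    by (simp add: Suc append_prod_def cart_prod_relabel_left[OF A] cart_prod_relabel_right[OF B]
        cart_prod_assoc relabel_relabel)
      (rule arg_cong[where f = "\<lambda>f. relabel f _"], auto)
qed

lemma pair_graph_complete_graph: "pair_graph (complete_graph q)"
  by (auto simp: pair_graph_iff complete_graph_def sym_def irrefl_def)

lemma pair_graph_hamming_graph: "pair_graph (hamming_graph d q)"
  unfolding hamming_graph_def by (intro pair_graph_cart_power pair_graph_complete_graph)

lemma pverts_hamming_graph:
  "pverts (hamming_graph d q) = {xs. length xs = d \<and> set xs \<subseteq> {1..q}}"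
  by (simp add: hamming_graph_def pverts_cart_power complete_graph_def)

lemma hamming_2_switches_to_shrikhande: "gm_switches_to (hamming_graph 2 4) shrikhande_graph"
  using gm_partition_diagonal by (auto simp: gm_switches_to_def shrikhande_graph_def)

lemma pair_graph_shrikhande_graph: "pair_graph shrikhande_graph"
  using gm_switches_toD(2)[OF hamming_2_switches_to_shrikhande pair_graph_hamming_graph] .

lemma pverts_shrikhande_graph: "pverts shrikhande_graph = pverts (hamming_graph 2 4)"
  using gm_switches_toD(1)[OF hamming_2_switches_to_shrikhande] .

lemma length_shrikhande_graph: "xs \<in> pverts shrikhande_graph \<Longrightarrow> length xs = 2"
  by (simp add: pverts_shrikhande_graph pverts_hamming_graph)

text \<open>
  Concatenating the coordinates keeps all intermediate graphs on the vertex set of the Hamming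
  graph, so that each step is an equality with a switched graph and not merely an isomorphism.
\<close>

primrec flat_doob_graph :: "nat \<Rightarrow> nat \<Rightarrow> nat list pair_pre_digraph" where
  "flat_doob_graph 0 r = hamming_graph r 4"
| "flat_doob_graph (Suc k) r = append_prod shrikhande_graph (flat_doob_graph k r)"

lemma pair_graph_flat_doob_graph: "pair_graph (flat_doob_graph k r)"
  by (induction k)
    (auto intro!: pair_graph_append_prod pair_graph_hamming_graph pair_graph_shrikhande_graph
      length_shrikhande_graph)

text \<open>Two Hamming coordinates are traded for one Shrikhande factor. For \<open>k = 0\<close>
  the first two coordinates are split off and switched; each further Shrikhande factor in front is a
  fixed left factor through which the switch lifts.\<close>

lemma flat_doob_graph_switches_to:
  "gm_switches_to (flat_doob_graph k (2 + r)) (flat_doob_graph (Suc k) r)"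
proof (induction k)
  case 0
  \<comment> \<open>A vertex for every \<open>r\<close>, being the empty list when
    \<open>r = 0\<close>.\<close>
  have "replicate r 1 \<in> pverts (hamming_graph r 4)"
    by (auto simp: pverts_hamming_graph)
  then have ne: "pverts (hamming_graph r 4) \<noteq> {}" by blast
  have "gm_switches_to (append_prod (hamming_graph 2 4) (hamming_graph r 4))
      (append_prod shrikhande_graph (hamming_graph r 4))"
    unfolding append_prod_def
    by (intro gm_switches_to_relabel gm_switches_to_cart_prod_left pair_graph_cart_prod
        hamming_2_switches_to_shrikhande pair_graph_hamming_graph ne)
      (auto intro!: inj_on_append simp: pverts_hamming_graph)
  then show ?case
    unfolding flat_doob_graph.simps hamming_graph_def
      cart_power_add[OF pair_graph_complete_graph, of _ 2 r] .
next
  case (Suc k)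
  have "[1, 1] \<in> pverts shrikhande_graph"
    by (simp add: pverts_shrikhande_graph pverts_hamming_graph)
  then have ne: "pverts shrikhande_graph \<noteq> {}" by blast
  have "gm_switches_to (append_prod shrikhande_graph (flat_doob_graph k (2 + r)))
      (append_prod shrikhande_graph (flat_doob_graph (Suc k) r))"
    unfolding append_prod_def
    by (intro gm_switches_to_relabel gm_switches_to_cart_prod_right pair_graph_cart_prod Suc
        pair_graph_shrikhande_graph pair_graph_flat_doob_graph ne)
      (auto intro!: inj_on_append length_shrikhande_graph)
  then show ?case by simp
qed

section \<open>Comparison with the Doob graph\<close>

text \<open>Again both sides of the induction step relabel one triple product; the labellings agree
  by associativity of append.\<close>

lemma flat_doob_graph_eq_relabel:
  "flat_doob_graph m n = relabel (\<lambda>(xss, ys). concat xss @ ys) (doob_graph m n)"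
proof (induction m)
  case 0
  show ?case
    using pair_graph_arcs_subset[OF pair_graph_hamming_graph]
    by (simp add: doob_graph_def hamming_graph_def relabel_singleton_cart_prod)
next
  case (Suc m)
  let ?S = "shrikhande_graph"
  let ?A = "cart_power ?S m" and ?B = "cart_power (complete_graph 4) n"
  have A: "parcs (?S \<box> ?A) \<subseteq> pverts (?S \<box> ?A) \<times> pverts (?S \<box> ?A)"
    and B: "parcs (?A \<box> ?B) \<subseteq> pverts (?A \<box> ?B) \<times> pverts (?A \<box> ?B)"
    by (intro pair_graph_arcs_subset pair_graph_cart_prod pair_graph_cart_power
        pair_graph_shrikhande_graph pair_graph_complete_graph)+
  show ?case
    by (simp add: Suc append_prod_def doob_graph_def cart_prod_relabel_left[OF A]
        cart_prod_relabel_right[OF B] cart_prod_assoc relabel_relabel)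
      (rule arg_cong[where f = "\<lambda>f. relabel f _"], auto)
qed

text \<open>Blocks of the fixed length \<open>l\<close> are peeled off one at a time, equally many
  on both sides. This gives injectivity of the flattening map on the Doob graph, with
  \<open>l = 2\<close>.\<close>

lemma concat_append_eq_imp:
  assumes "concat xss @ ys = concat xss' @ ys'" "length xss = length xss'"
    and "\<And>xs. xs \<in> set xss \<Longrightarrow> length xs = l" "\<And>xs. xs \<in> set xss' \<Longrightarrow> length xs = l"
  shows "xss = xss' \<and> ys = ys'"
  using assms(2,1,3,4)
proof (induction xss xss' rule: list_induct2)
  case (Cons xs xss xs' xss')
  have "length xs = length xs'" using Cons.prems(2,3) by (metis list.set_intros(1))
  with Cons.prems(1) have "xs = xs'" "concat xss @ ys = concat xss' @ ys'" by simp_all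
  moreover have "xss = xss' \<and> ys = ys'"
    using Cons.IH \<open>concat xss @ ys = concat xss' @ ys'\<close> Cons.prems(2,3) by (meson list.set_intros(2))
  ultimately show ?case by simp
qed simp

lemma digraph_iso_flat_doob_graph:
  "digraph_iso (with_proj (flat_doob_graph m n)) (with_proj (doob_graph m n))"
  unfolding flat_doob_graph_eq_relabel
proof (rule digraph_iso_relabel_sym)
  show "pair_graph (doob_graph m n)"
    unfolding doob_graph_def
    by (intro pair_graph_cart_prod pair_graph_cart_power pair_graph_shrikhande_graph
        pair_graph_complete_graph)
  have len: "length xss = m" "\<And>xs. xs \<in> set xss \<Longrightarrow> length xs = 2"
    if "(xss, ys) \<in> pverts (doob_graph m n)" for xss ys
    using that length_shrikhande_graph by (auto simp: doob_graph_def pverts_cart_power)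
  show "inj_on (\<lambda>(xss, ys). concat xss @ ys) (pverts (doob_graph m n))"
  proof (rule inj_onI)
    fix p q assume p: "p \<in> pverts (doob_graph m n)" and q: "q \<in> pverts (doob_graph m n)"
      and eq: "(case p of (xss, ys) \<Rightarrow> concat xss @ ys) = (case q of (xss, ys) \<Rightarrow> concat xss @ ys)"
    obtain xss ys xss' ys' where pq: "p = (xss, ys)" "q = (xss', ys')"
      by (metis surj_pair)
    have "length xss = length xss'" using len(1) p q pq by simp
    moreover have "concat xss @ ys = concat xss' @ ys'" using eq pq by simp
    ultimately have "xss = xss' \<and> ys = ys'"
      using concat_append_eq_imp len(2)[OF p[unfolded pq]] len(2)[OF q[unfolded pq]] by blast
    then show "p = q" using pq by simp
  qed
qed

theorem theorem5p1:
  fixes m n :: nat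
  assumes "m \<ge> 1"
  shows "\<exists>\<Gamma> :: nat \<Rightarrow> nat list pair_pre_digraph.
    (\<forall>k\<in>{0..m}. pair_graph (\<Gamma> k)) \<and>
    \<Gamma> 0 = hamming_graph (2 * m + n) 4 \<and>
    (\<forall>k\<in>{1..m}. \<exists>\<C> D. gm_partition (\<Gamma> (k - 1)) \<C> D \<and>
        digraph_iso (with_proj (\<Gamma> k)) (with_proj (gm_switch (\<Gamma> (k - 1)) \<C> D))) \<and>
    digraph_iso (with_proj (\<Gamma> m)) (with_proj (doob_graph m n))"
proof (intro exI[of _ "\<lambda>k. flat_doob_graph k (2 * (m - k) + n)"] conjI ballI)
  \<comment> \<open>After \<open>k\<close> switches there are \<open>k\<close> Shrikhande factors
    and \<open>2 * (m - k) + n\<close> remaining coordinates over the complete graph: the Hamming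
    graph for \<open>k = 0\<close>, the flattened Doob graph for \<open>k = m\<close>.\<close>
  let ?\<Gamma> = "\<lambda>k. flat_doob_graph k (2 * (m - k) + n)"
  fix k assume "k \<in> {1..m}"
  \<comment> \<open>Since \<open>k\<close> lies between 1 and \<open>m\<close>, truncated
    subtraction is harmless and \<open>m - j\<close> exceeds \<open>m - k\<close> by one, which
    frees the two coordinates to be switched.\<close>
  then obtain j where j: "k = Suc j" "2 * (m - j) + n = 2 + (2 * (m - k) + n)"
    by (cases k) auto
  then have "gm_switches_to (?\<Gamma> (k - 1)) (?\<Gamma> k)"
    using flat_doob_graph_switches_to[of j "2 * (m - k) + n"] by simp
  then obtain \<C> D where "gm_partition (?\<Gamma> (k - 1)) \<C> D" "?\<Gamma> k = gm_switch (?\<Gamma> (k - 1)) \<C> D"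
    by (auto simp: gm_switches_to_def)
  \<comment> \<open>The graphs are equal, so the identity relabelling supplies the
    isomorphism.\<close>
  moreover have "digraph_iso (with_proj (?\<Gamma> k)) (with_proj (?\<Gamma> k))"
    using digraph_iso_relabel[OF pair_graph_flat_doob_graph, of id] by simp
  ultimately show "\<exists>\<C> D. gm_partition (?\<Gamma> (k - 1)) \<C> D \<and>
      digraph_iso (with_proj (?\<Gamma> k)) (with_proj (gm_switch (?\<Gamma> (k - 1)) \<C> D))"
    by metis
qed (simp_all add: pair_graph_flat_doob_graph digraph_iso_flat_doob_graph)

end
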